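(* Let $m,n\ge 1$, $d=m+n$, and let $X$ together with the assignment $x\mapsto\Lambda_x\subset\mathbb{R}^d\setminus\{0\}$ be a Minkowski system for $SL(d,\mathbb{R})$. For all $x\in X$ such that $\Lambda_x$ does not have vertical vectors, $$\beta(x)=\frac{n}{d}+\gamma(x)=1-\frac{1}{\mu(x)}.$$
   Context: A Minkowski system is a non-compact topological space $X$ with an action of $SL(d,\mathbb{R})$ ($d\ge 2$) and an $SL(d,\mathbb{R})$-equivariant assignment $x\mapsto\Lambda_x\subset\mathbb{R}^d\setminus\{0\}$ (so $\Lambda_{gx}=g\Lambda_x$), where each $\Lambda_x$ is infinite and discrete (only finitely many points in each bounded set) and satisfies the Minkowski condition: there is $C=C_x$ such that every convex, centrally symmetric $K\subset\mathbb{R}^d$ with $\mathrm{vol}(K)>C$ contains some $\mathbf{v}\in\Lambda_x$. Write $\mathbb{R}^d=\mathbb{R}^m\times\mathbb{R}^n$ with projections $p_1,p_2$. A vector $\mathbf{v}$ is vertical if $p_1(\mathbf{v})=0$. Let $\|\mathbf{v}\|=\max(\|p_1(\mathbf{v})\|_2,\|p_2(\mathbf{v})\|_2)$, where $\|\cdot\|_2$ is the Euclidean norm (also used for matrices), and $\alpha_1(x)=\sup_{\mathbf{v}\in\Lambda_x}1/\|\mathbf{v}\|$. Let $$g_t=\begin{pmatrix}e^{nt/d}I_m&0\\0&e^{-mt/d}I_n\end{pmatrix},\qquad h_B=\begin{pmatrix}I_m&0\\ B&I_n\end{pmatrix}\ (B\in M_{n\times m}(\mathbb{R})),\qquad \mathcal{B}_s=\{h_B:\|B\|_2\le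 s\}.$$ Define $$\beta(x)=\limsup_{s\to\infty}\frac{\sup_{h\in\mathcal{B}_s}\log\alpha_1(hx)}{\log s},\qquad \gamma(x)=\limsup_{t\to\infty}\frac{\log\alpha_1(g_tx)}{t}.$$ For $\Lambda_x$ without vertical vectors, $\mathrm{Exp}(x)$ is the set of all $\nu>0$ for which there are $C>0$ and a sequence $\mathbf{v}_k\in\Lambda_x$ with $\|p_2(\mathbf{v}_k)\|_2\to\infty$ and $\|p_1(\mathbf{v}_k)\|_2\le C\|p_2(\mathbf{v}_k)\|_2^{-(\nu-1)}$, and $\mu(x)=\sup\mathrm{Exp}(x)\in\mathbb{R}\cup\{+\infty\}$ (with $1/\infty=0$). *)

theory Defs
  imports "HOL-Analysis.Analysis" "HOL-Algebra.Group_Action"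
begin

definition SL_group :: "(real^'d::finite^'d) monoid" where
  "SL_group = \<lparr>carrier = {A. det A = 1}, mult = (**), one = mat 1\<rparr>"

text \<open>
  The action is only required to be an action of the abstract group; no continuity is assumed.
  Every convex set is Lebesgue measurable, so \<^term>\<open>emeasure lebesgue K\<close> is its volume
  (possibly infinite) and no measurability hypothesis on \<open>K\<close> is needed.
\<close>

locale minkowski_system =
  group_action "SL_group :: (real^'d::finite^'d) monoid" "topspace X" act
  for X :: "'x topology" and act :: "real^'d^'d \<Rightarrow> 'x \<Rightarrow> 'x" +
  fixes Lam :: "'x \<Rightarrow> (real^'d) set"
  assumes dim_ge_2: "CARD('d) \<ge> 2"
    and noncompact: "\<not> compact_space X"
    and equivariant:
      "\<And>g x. det g = 1 \<Longrightarrow> x \<in> topspace X \<Longrightarrow> Lam (act g x) = (\<lambda>v. g *v v) ` Lam x"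
    and zero_notin: "\<And>x. x \<in> topspace X \<Longrightarrow> 0 \<notin> Lam x"
    and infinite_Lam: "\<And>x. x \<in> topspace X \<Longrightarrow> infinite (Lam x)"
    and discrete_Lam:
      "\<And>x S. x \<in> topspace X \<Longrightarrow> bounded S \<Longrightarrow> finite (Lam x \<inter> S)"
    and minkowski_condition:
      "\<And>x. x \<in> topspace X \<Longrightarrow>
         \<exists>C::real. \<forall>K. convex K \<and> (\<forall>v\<in>K. - v \<in> K) \<and> emeasure lebesgue K > ennreal C
           \<longrightarrow> (\<exists>v\<in>Lam x. v \<in> K)"

text \<open>
  \<open>R\<^sup>d = R\<^sup>m \<times> R\<^sup>n\<close> is rendered by the index type \<^typ>\<open>'m + 'n\<close>.
\<close>

definition p1 :: "real^('m::finite + 'n::finite) \<Rightarrow> real^'m" where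
  "p1 v = (\<chi> i. v $ Inl i)"

definition p2 :: "real^('m::finite + 'n::finite) \<Rightarrow> real^'n" where
  "p2 v = (\<chi> j. v $ Inr j)"

definition vertical :: "real^('m::finite + 'n::finite) \<Rightarrow> bool" where
  "vertical v \<longleftrightarrow> p1 v = 0"

definition max_norm :: "real^('m::finite + 'n::finite) \<Rightarrow> real" where
  "max_norm v = max (norm (p1 v)) (norm (p2 v))"

text \<open>
  In a Minkowski system this supremum runs over a nonempty set of positive reals that is
  bounded above, by discreteness, so it may be taken in the reals, and it is positive.
\<close>

definition alpha1 :: "('x \<Rightarrow> (real^('m::finite + 'n::finite)) set) \<Rightarrow> 'x \<Rightarrow> real" where
  "alpha1 Lam x = (SUP v\<in>Lam x. 1 / max_norm v)"

definition block_matrix ::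
    "real^'m::finite^'m \<Rightarrow> real^'n::finite^'m \<Rightarrow> real^'m^'n \<Rightarrow> real^'n^'n \<Rightarrow> real^('m + 'n)^('m + 'n)" where
  "block_matrix P Q R S =
     (\<chi> i j. case i of
        Inl a \<Rightarrow> (case j of Inl b \<Rightarrow> P $ a $ b | Inr b \<Rightarrow> Q $ a $ b)
      | Inr a \<Rightarrow> (case j of Inl b \<Rightarrow> R $ a $ b | Inr b \<Rightarrow> S $ a $ b))"

definition diag_flow :: "real \<Rightarrow> real^('m::finite + 'n::finite)^('m + 'n)" where
  "diag_flow t =
     (let m = real CARD('m); n = real CARD('n); d = m + n in
      block_matrix (mat (exp (n * t / d))) 0 0 (mat (exp (- (m * t / d)))))"

definition shear :: "real^'m::finite^'n::finite \<Rightarrow> real^('m + 'n)^('m + 'n)" where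
  "shear B = block_matrix (mat 1) 0 B (mat 1)"

text \<open>
  The norm on \<^typ>\<open>real^'m^'n\<close> is the Euclidean norm of the matrix entries.
\<close>

definition shear_ball :: "real \<Rightarrow> (real^('m::finite + 'n::finite)^('m + 'n)) set" where
  "shear_ball s = {shear B | B. norm B \<le> s}"

definition beta ::
    "(real^('m::finite + 'n::finite)^('m + 'n) \<Rightarrow> 'x \<Rightarrow> 'x) \<Rightarrow> ('x \<Rightarrow> (real^('m + 'n)) set) \<Rightarrow> 'x \<Rightarrow> ereal" where
  "beta act Lam x =
     Limsup at_top (\<lambda>s::real. (SUP h\<in>shear_ball s. ereal (ln (alpha1 Lam (act h x)))) / ereal (ln s))"

definition gamma ::
    "(real^('m::finite + 'n::finite)^('m + 'n) \<Rightarrow> 'x \<Rightarrow> 'x) \<Rightarrow> ('x \<Rightarrow> (real^('m + 'n)) set) \<Rightarrow> 'x \<Rightarrow> ereal" where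
  "gamma act Lam x =
     Limsup at_top (\<lambda>t::real. ereal (ln (alpha1 Lam (act (diag_flow t) x)) / t))"

text \<open>
  Since \<open>0 powr a = 0\<close>, the inequality below excludes nonzero vectors with \<open>p2 v = 0\<close>.
  Only finitely many terms of a sequence with \<open>norm (p2 (v k)) \<longlonglongrightarrow> \<infinity>\<close> can be of this form, so this
  convention does not affect the set.
\<close>

definition Exp_set :: "('x \<Rightarrow> (real^('m::finite + 'n::finite)) set) \<Rightarrow> 'x \<Rightarrow> real set" where
  "Exp_set Lam x =
     {\<nu>. \<nu> > 0 \<and>
        (\<exists>C>0. \<exists>v :: nat \<Rightarrow> real^('m + 'n).
           (\<forall>k. v k \<in> Lam x) \<and>
           filterlim (\<lambda>k. norm (p2 (v k))) at_top sequentially \<and>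
           (\<forall>k. norm (p1 (v k)) \<le> C * norm (p2 (v k)) powr (- (\<nu> - 1))))}"

definition mu :: "('x \<Rightarrow> (real^('m::finite + 'n::finite)) set) \<Rightarrow> 'x \<Rightarrow> ereal" where
  "mu Lam x = Sup (ereal ` Exp_set Lam x)"

end

theory Submission
  imports Defs
begin

text \<open>
  Both growth rates measure the same Diophantine property of \<open>\<Lambda>\<^sub>x\<close>.  Put \<open>s = e\<^sup>t\<close> and fix a real
  \<open>\<kappa>\<close>.  The first minimum of some \<open>h\<^sub>B x\<close> with \<open>|B| \<le> s\<close> being shorter than \<open>s\<^sup>-\<^sup>\<kappa>\<close> means, up to a
  factor 2, that some \<open>v \<in> \<Lambda>\<^sub>x\<close> satisfies
  \<open>|p1 v| \<le> s\<^sup>-\<^sup>\<kappa>\<close> and \<open>|p2 v| \<le> s\<^sup>1\<^sup>-\<^sup>\<kappa>\<close>, because a shear of norm \<open>s\<close> can reduce \<open>|p2 v|\<close> by at most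
  \<open>s |p1 v|\<close>.  The same pair of inequalities says that \<open>g\<^sub>t\<close> makes \<open>v\<close> shorter than
  \<open>e\<close> to the power \<open>-(\<kappa> - n/d) t\<close>, which accounts for the summand \<open>n/d\<close>.

  It remains to see that such vectors occur at arbitrarily large scales \<open>s\<close> precisely for \<open>\<kappa>\<close> up to
  \<open>1 - 1/\<mu>\<close>.  Eliminating \<open>s\<close> bounds \<open>|p1 v|\<close> by a constant times \<open>|p2 v|\<close> to the power \<open>-(\<nu> - 1)\<close> with
  \<open>\<nu> = 1/(1 - \<kappa>)\<close>; since \<open>\<Lambda>\<^sub>x\<close> is discrete without vertical vectors, \<open>|p1 v| \<rightarrow> 0\<close> forces
  \<open>|p2 v| \<rightarrow> \<infinity>\<close>, so \<open>\<nu>\<close> is an exponent (\<open>Exp_set_of_scales\<close>).  Conversely, a sequence realizing an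
  exponent is used at the scales \<open>s = |p2 v| / |p1 v|\<close> (\<open>scales_of_Exp_set\<close>).  The Minkowski
  condition enters only through \<open>d/m\<close> being an exponent (\<open>Dirichlet_exponent\<close>): this gives
  \<open>\<mu> > 1\<close>, so that only positive \<open>\<kappa>\<close> matter.  \<open>Limsup_eq_exponent\<close> states this for an abstract
  rate function and is applied to \<open>\<beta>\<close> and to \<open>n/d + \<gamma>\<close>.
\<close>

section \<open>Block matrices acting on the two factors\<close>

lemma sum_UNIV_sum:
  fixes f :: "'m::finite + 'n::finite \<Rightarrow> 'b::comm_monoid_add"
  shows "sum f UNIV = (\<Sum>i\<in>UNIV. f (Inl i)) + (\<Sum>j\<in>UNIV. f (Inr j))"
  by (simp add: UNIV_Plus_UNIV [symmetric] sum.Plus del: UNIV_Plus_UNIV)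

lemma prod_UNIV_sum:
  fixes f :: "'m::finite + 'n::finite \<Rightarrow> 'b::comm_monoid_mult"
  shows "prod f UNIV = (\<Prod>i\<in>UNIV. f (Inl i)) * (\<Prod>j\<in>UNIV. f (Inr j))"
  by (simp add: UNIV_Plus_UNIV [symmetric] prod.Plus del: UNIV_Plus_UNIV)

lemma p1_block_matrix: "p1 (block_matrix P Q R S *v v) = P *v p1 v + Q *v p2 v"
  by (simp add: p1_def p2_def block_matrix_def vec_eq_iff matrix_vector_mult_def sum_UNIV_sum)

lemma p2_block_matrix: "p2 (block_matrix P Q R S *v v) = R *v p1 v + S *v p2 v"
  by (simp add: p1_def p2_def block_matrix_def vec_eq_iff matrix_vector_mult_def sum_UNIV_sum)

lemma mat_vector_mult: "(mat c :: real^'k^'k) *v a = c *\<^sub>R a"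
  by (simp add: vec_eq_iff matrix_vector_mult_def mat_def if_distrib if_distribR cong: if_cong)

lemma p1_p2_eqI: "p1 v = p1 w \<Longrightarrow> p2 v = p2 w \<Longrightarrow> v = w"
  unfolding p1_def p2_def vec_eq_iff by (simp, metis sum.exhaust)

lemma det_diag_block:
  "det (block_matrix (mat a) 0 0 (mat b) :: real^('m::finite + 'n::finite)^('m + 'n))
     = a ^ CARD('m) * b ^ CARD('n)"
  by (subst det_diagonal)
     (auto simp: block_matrix_def mat_def prod_UNIV_sum split: sum.splits)

lemma det_diag_flow: "det (diag_flow t :: real^('m::finite + 'n::finite)^('m + 'n)) = 1"
  unfolding diag_flow_def Let_def det_diag_block
  by (simp add: exp_of_nat_mult [symmetric] exp_add [symmetric])

lemma p1_diag_flow: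
  "p1 (diag_flow t *v (v :: real^('m::finite + 'n::finite))) =
     exp (real CARD('n) * t / (real CARD('m) + real CARD('n))) *\<^sub>R p1 v"
  by (simp add: diag_flow_def Let_def p1_block_matrix mat_vector_mult)

lemma p2_diag_flow:
  "p2 (diag_flow t *v (v :: real^('m::finite + 'n::finite))) =
     exp (- (real CARD('m) * t / (real CARD('m) + real CARD('n)))) *\<^sub>R p2 v"
  by (simp add: diag_flow_def Let_def p2_block_matrix mat_vector_mult)

lemma p1_shear: "p1 (shear B *v v) = p1 v"
  by (simp add: shear_def p1_block_matrix)

lemma p2_shear: "p2 (shear B *v v) = B *v p1 v + p2 v"
  by (simp add: shear_def p2_block_matrix)

lemma shear_add: "shear (A + B) = shear A ** shear B"
  unfolding matrix_eq
  by (auto intro!: p1_p2_eqI simp: p1_shear p2_shear matrix_vector_mul_assoc [symmetric]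
       matrix_vector_mult_add_rdistrib)

lemma shear_zero: "shear 0 = mat 1"
  unfolding matrix_eq by (auto intro!: p1_p2_eqI simp: p1_shear p2_shear)

text \<open>
  The index type carries no linear order, so the formula for triangular determinants does not
  apply.  Instead, conjugation by \<open>diag(1, 2)\<close> takes \<open>shear B\<close> to \<open>shear (2 B)\<close>,
  which is also the square of \<open>shear B\<close>; hence its determinant is a nonzero idempotent.
\<close>

lemma det_shear: "det (shear B :: real^('m::finite + 'n::finite)^('m + 'n)) = 1"
proof -
  define D :: "real^('m + 'n)^('m + 'n)" where "D = block_matrix (mat 1) 0 0 (mat 2)"
  define C where "C = B + B"
  have "C *v a = 2 *\<^sub>R (B *v a)" for a
    by (simp only: C_def matrix_vector_mult_add_rdistrib scaleR_2)
  then have "D ** shear B = shear C ** D"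
    unfolding matrix_eq
    by (auto intro!: p1_p2_eqI simp: D_def p1_shear p2_shear p1_block_matrix p2_block_matrix
         mat_vector_mult matrix_vector_mul_assoc [symmetric] scaleR_add_right)
  then have "det D * det (shear B) = det (shear B) * det (shear B) * det D"
    unfolding C_def by (metis det_mul shear_add)
  moreover have "det D \<noteq> 0"
    unfolding D_def det_diag_block by simp
  moreover have "det (shear B) \<noteq> 0"
  proof -
    have "det (shear B) * det (shear (- B)) = 1"
      by (metis det_mul shear_add shear_zero add.right_inverse det_I)
    then show ?thesis by auto
  qed
  ultimately show ?thesis
    by simp
qed

lemma norm_matrix_vector_mult_le:
  fixes B :: "real^'m::finite^'n::finite"
  shows "norm (B *v a) \<le> norm B * norm a"
proof -
  have "norm (B *v a) = L2_set (\<lambda>i. \<bar>B $ i \<bullet> a\<bar>) UNIV"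
    by (simp add: norm_vec_def [where x = "B *v a"] matrix_vector_mul_component)
  also have "\<dots> \<le> L2_set (\<lambda>i. norm (B $ i) * norm a) UNIV"
    by (intro L2_set_mono Cauchy_Schwarz_ineq2) auto
  also have "\<dots> = norm B * norm a"
    by (simp add: norm_vec_def [where x = B] L2_set_left_distrib)
  finally show ?thesis .
qed

text \<open>
  The witness is the rank one matrix \<open>- b a\<^sup>T / |a|\<^sup>2\<close>.  By \<open>norm_matrix_vector_mult_le\<close>, no matrix
  of smaller norm maps \<open>a\<close> to \<open>- b\<close>.
\<close>

lemma ex_matrix_cancel:
  fixes a :: "real^'m::finite" and b :: "real^'n::finite"
  assumes "a \<noteq> 0"
  obtains B :: "real^'m^'n" where "B *v a + b = 0" "norm B = norm b / norm a"
proof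
  define c where "c = - 1 / (a \<bullet> a)"
  define B :: "real^'m^'n" where "B = (\<chi> i. (c * b $ i) *\<^sub>R a)"
  show "B *v a + b = 0"
    using assms by (simp add: vec_eq_iff matrix_vector_mul_component B_def c_def)
  have "norm B = L2_set (\<lambda>i. (\<bar>c\<bar> * norm a) * \<bar>b $ i\<bar>) UNIV"
    unfolding norm_vec_def [where x = B] by (simp add: B_def abs_mult mult_ac)
  also have "\<dots> = \<bar>c\<bar> * norm a * norm b"
    by (subst L2_set_right_distrib [symmetric]) (auto simp: norm_vec_def)
  also have "\<dots> = norm b / norm a"
    using assms by (simp add: c_def dot_square_norm power2_eq_square)
  finally show "norm B = norm b / norm a" .
qed

section \<open>The first minimum\<close>

lemma norm_le_p1_p2: "norm v \<le> norm (p1 v) + norm (p2 v)"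
proof -
  have "norm v = sqrt ((norm (p1 v))\<^sup>2 + (norm (p2 v))\<^sup>2)"
    by (simp add: norm_vec_def L2_set_def sum_UNIV_sum p1_def p2_def sum_nonneg)
  also have "\<dots> \<le> norm (p1 v) + norm (p2 v)"
    by (rule sqrt_sum_squares_le_sum) auto
  finally show ?thesis .
qed

lemma max_norm_pos: "v \<noteq> 0 \<Longrightarrow> max_norm v > 0"
  using norm_le_p1_p2 [of v] by (auto simp: max_norm_def less_max_iff_disj)

text \<open>Discreteness makes the supremum defining \<^const>\<open>alpha1\<close> a genuine one.\<close>

lemma bdd_above_inverse_max_norm:
  fixes L :: "(real^('m::finite + 'n::finite)) set"
  assumes "\<And>S. bounded S \<Longrightarrow> finite (L \<inter> S)"
  shows "bdd_above ((\<lambda>v. 1 / max_norm v) ` L)"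
proof -
  let ?S = "cball 0 2 :: (real^('m + 'n)) set"
  have "1 / max_norm v \<le> 1" if "v \<notin> ?S" for v :: "real^('m + 'n)"
  proof -
    have "max_norm v \<ge> 1"
      using that norm_le_p1_p2 [of v] by (auto simp: max_norm_def le_max_iff_disj)
    then show ?thesis by simp
  qed
  then have "bdd_above ((\<lambda>v. 1 / max_norm v) ` (L - ?S))"
    by (intro bdd_aboveI [where M = 1]) auto
  moreover have "bdd_above ((\<lambda>v. 1 / max_norm v) ` (L \<inter> ?S))"
    using assms [of ?S] by auto
  moreover have "L = (L - ?S) \<union> (L \<inter> ?S)" by auto
  ultimately show ?thesis
    by (metis bdd_above_Un image_Un)
qed

section \<open>Approximation vectors and the exponent\<close>

text \<open>
  If arbitrarily large scales \<open>s\<close> admit a vector with \<open>|p1 v| \<le> s\<^sup>-\<^sup>\<kappa>\<close> and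
  \<open>|p2 v| \<le> K s\<^sup>1\<^sup>-\<^sup>\<kappa>\<close>, then \<open>1 / (1 - \<kappa>)\<close> is an admissible exponent.  Since no vector is
  vertical, \<open>|p1 v|\<close> is bounded below on bounded sets, so the vectors found escape to infinity.
\<close>

lemma Exp_set_of_scales:
  fixes Lam :: "'x \<Rightarrow> (real^('m::finite + 'n::finite)) set"
  assumes discrete: "\<And>S. bounded S \<Longrightarrow> finite (Lam x \<inter> S)"
    and nonvertical: "\<And>v. v \<in> Lam x \<Longrightarrow> p1 v \<noteq> 0"
    and "\<kappa> > 0" "K > 0"
    and scales: "\<exists>\<^sub>F s in at_top. \<exists>v\<in>Lam x.
        norm (p1 v) \<le> s powr (- \<kappa>) \<and> norm (p2 v) \<le> K * s powr (1 - \<kappa>)"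
  shows "\<kappa> < 1" and "1 / (1 - \<kappa>) \<in> Exp_set Lam x"
proof -
  have far: "\<exists>v\<in>Lam x. \<exists>s\<ge>1. norm (p2 v) > N \<and>
      norm (p1 v) \<le> s powr (- \<kappa>) \<and> norm (p2 v) \<le> K * s powr (1 - \<kappa>)" for N :: real
  proof -
    let ?S = "cball 0 (1 + N) :: (real^('m + 'n)) set"
    have fin: "finite ((\<lambda>v. norm (p1 v)) ` (Lam x \<inter> ?S))"
      using discrete by auto
    \<comment> \<open>A vector of the set with \<open>|p1 v| < \<delta>\<close> lies outside the ball of radius \<open>1 + N\<close>.\<close>
    define \<delta> where "\<delta> = Min (insert 1 ((\<lambda>v. norm (p1 v)) ` (Lam x \<inter> ?S)))"
    have "\<delta> > 0"
      using fin nonvertical by (auto simp: \<delta>_def)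
    have "((\<lambda>s. s powr (- \<kappa>)) \<longlongrightarrow> 0) at_top"
      using \<open>\<kappa> > 0\<close> by (intro tendsto_neg_powr filterlim_ident) auto
    then have "\<forall>\<^sub>F s in at_top. s powr (- \<kappa>) < \<delta>"
      using \<open>\<delta> > 0\<close> by (rule order_tendstoD)
    then have fr: "\<exists>\<^sub>F s in at_top. (\<exists>v\<in>Lam x. norm (p1 v) \<le> s powr (- \<kappa>) \<and>
        norm (p2 v) \<le> K * s powr (1 - \<kappa>)) \<and> s powr (- \<kappa>) < \<delta> \<and> s \<ge> 1"
      using scales eventually_ge_at_top [of "1::real"]
      by (intro frequently_eventually_frequently) (auto intro: eventually_conj)
    obtain s v where sv: "v \<in> Lam x" "norm (p1 v) \<le> s powr (- \<kappa>)"
        "norm (p2 v) \<le> K * s powr (1 - \<kappa>)" "s powr (- \<kappa>) < \<delta>" "s \<ge> 1"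
      using frequently_ex [OF fr] by blast
    have "norm (p1 v) < \<delta>" using sv by simp
    moreover have "\<delta> \<le> 1" using fin by (simp add: \<delta>_def)
    moreover have "\<delta> \<le> norm (p1 v)" if "norm (p2 v) \<le> N"
    proof -
      have "norm v \<le> 1 + N"
        using norm_le_p1_p2 [of v] that \<open>norm (p1 v) < \<delta>\<close> \<open>\<delta> \<le> 1\<close> by linarith
      then show ?thesis
        using fin sv(1) by (auto simp: \<delta>_def intro!: Min_le)
    qed
    ultimately have "norm (p2 v) > N" by linarith
    with sv show ?thesis by blast
  qed
  show "\<kappa> < 1"
  proof (rule ccontr)
    assume "\<not> \<kappa> < 1"
    obtain v s where v: "v \<in> Lam x" "s \<ge> (1::real)" "norm (p2 v) > K" "norm (p2 v) \<le> K * s powr (1 - \<kappa>)"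
      using far [of K] by blast
    have "s powr (1 - \<kappa>) \<le> s powr 0"
      using v \<open>\<not> \<kappa> < 1\<close> by (intro powr_mono) auto
    then have "K * s powr (1 - \<kappa>) \<le> K * 1"
      using \<open>K > 0\<close> v by (intro mult_left_mono) auto
    with v show False by simp
  qed
  define \<nu> where "\<nu> = 1 / (1 - \<kappa>)"
  have \<nu>: "\<nu> - 1 = \<kappa> / (1 - \<kappa>)" "\<nu> > 0"
    using \<open>\<kappa> < 1\<close> by (auto simp: \<nu>_def field_simps)
  have "\<exists>v. v \<in> Lam x \<and> norm (p2 v) > real k \<and>
      norm (p1 v) \<le> K powr (\<nu> - 1) * norm (p2 v) powr (- (\<nu> - 1))" for k
  proof -
    obtain v s where v: "v \<in> Lam x" "s \<ge> (1::real)" "norm (p2 v) > real k"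
        "norm (p1 v) \<le> s powr (- \<kappa>)" "norm (p2 v) \<le> K * s powr (1 - \<kappa>)"
      using far [of k] by blast
    have pos: "norm (p2 v) > 0" using v(3) by (meson of_nat_0_le_iff order_le_less_trans)
    have "norm (p2 v) / K \<le> s powr (1 - \<kappa>)"
      using v(5) \<open>K > 0\<close> by (simp add: field_simps)
    then have "(s powr (1 - \<kappa>)) powr (- (\<nu> - 1)) \<le> (norm (p2 v) / K) powr (- (\<nu> - 1))"
      using \<nu>(1) \<open>\<kappa> < 1\<close> \<open>\<kappa> > 0\<close> \<open>K > 0\<close> pos by (intro powr_mono2') auto
    moreover have "(s powr (1 - \<kappa>)) powr (- (\<nu> - 1)) = s powr (- \<kappa>)"
      using \<nu>(1) \<open>\<kappa> < 1\<close> by (simp add: powr_powr)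
    moreover have "(norm (p2 v) / K) powr (- (\<nu> - 1))
        = K powr (\<nu> - 1) * norm (p2 v) powr (- (\<nu> - 1))"
      using pos \<open>K > 0\<close> by (simp add: powr_divide powr_minus_divide del: minus_diff_eq)
    ultimately show ?thesis using v by (intro exI [of _ v]) auto
  qed
  then obtain v where v: "\<And>k. v k \<in> Lam x" "\<And>k. norm (p2 (v k)) > real k"
      "\<And>k. norm (p1 (v k)) \<le> K powr (\<nu> - 1) * norm (p2 (v k)) powr (- (\<nu> - 1))"
    by metis
  have "filterlim (\<lambda>k. norm (p2 (v k))) at_top sequentially"
    by (rule filterlim_at_top_mono [OF filterlim_real_sequentially])
       (use v(2) in \<open>auto intro!: always_eventually less_imp_le\<close>)
  then show "1 / (1 - \<kappa>) \<in> Exp_set Lam x"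
    using v \<nu>(2) \<open>K > 0\<close> unfolding Exp_set_def \<nu>_def [symmetric]
    by (auto intro!: exI [of _ "K powr (\<nu> - 1)"] exI [of _ v])
qed

text \<open>
  In the other direction, an exponent \<open>\<nu> > 1\<close> yields vectors at the scales
  \<open>s = |p2 v| / |p1 v|\<close>, at which \<open>|p1 v|\<close> is at most about \<open>s\<close> to the power \<open>-(1 - 1/\<nu>)\<close>.
\<close>

lemma scales_of_Exp_set:
  fixes Lam :: "'x \<Rightarrow> (real^('m::finite + 'n::finite)) set"
  assumes nonvertical: "\<And>v. v \<in> Lam x \<Longrightarrow> p1 v \<noteq> 0"
    and "\<nu> \<in> Exp_set Lam x" "\<nu> > 1" "\<kappa> < 1 - 1 / \<nu>"
  shows "\<exists>\<^sub>F s in at_top. \<exists>v\<in>Lam x. s = norm (p2 v) / norm (p1 v) \<and>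
           \<kappa> \<le> ln (1 / norm (p1 v)) / ln s"
proof -
  obtain C v where C: "C > 0" and v: "\<And>k::nat. v k \<in> Lam x"
      and lim: "filterlim (\<lambda>k. norm (p2 (v k))) at_top sequentially"
      and le: "\<And>k. norm (p1 (v k)) \<le> C * norm (p2 (v k)) powr (- (\<nu> - 1))"
    using assms(2) unfolding Exp_set_def by blast
  define s where "s k = norm (p2 (v k)) / norm (p1 (v k))" for k
  \<comment> \<open>As \<open>\<nu> > 1\<close>, the numbers \<open>|p1 (v k)|\<close> are eventually at most \<open>C\<close>, so \<open>s k\<close> tends to infinity.\<close>
  have "filterlim (\<lambda>k. (1 / C) * norm (p2 (v k))) at_top sequentially"
    using C by (intro filterlim_tendsto_pos_mult_at_top [OF tendsto_const _ lim]) auto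
  moreover have "\<forall>\<^sub>F k in sequentially. (1 / C) * norm (p2 (v k)) \<le> s k"
    using filterlim_at_top [THEN iffD1, OF lim, THEN spec, of 1]
  proof (eventually_elim)
    case (elim k)
    have "norm (p2 (v k)) powr (- (\<nu> - 1)) \<le> norm (p2 (v k)) powr 0"
      using elim assms by (intro powr_mono) auto
    then have "C * norm (p2 (v k)) powr (- (\<nu> - 1)) \<le> C * 1"
      using elim C by (intro mult_left_mono) (auto split: if_splits)
    then have "norm (p1 (v k)) \<le> C" using le [of k] by simp
    then show ?case
      using nonvertical [OF v] C by (auto simp: s_def intro!: divide_left_mono)
  qed
  ultimately have s_lim: "filterlim s at_top sequentially"
    by (rule filterlim_at_top_mono)
  then have ln_s: "filterlim (\<lambda>k. ln (s k)) at_top sequentially"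
    by (rule filterlim_compose [OF ln_at_top])
  define \<epsilon> where "\<epsilon> = 1 - 1 / \<nu> - \<kappa>"
  have "\<epsilon> > 0" using assms by (simp add: \<epsilon>_def)
  have "\<forall>\<^sub>F k in sequentially. \<kappa> \<le> ln (1 / norm (p1 (v k))) / ln (s k)"
    using filterlim_at_top [THEN iffD1, OF lim, THEN spec, of 1]
      filterlim_at_top [THEN iffD1, OF ln_s, THEN spec, of 1]
      filterlim_at_top [THEN iffD1, OF ln_s, THEN spec, of "ln C / (\<nu> * \<epsilon>)"]
  proof (eventually_elim)
    case (elim k)
    let ?a = "norm (p1 (v k))" and ?b = "norm (p2 (v k))"
    have a: "?a > 0" using nonvertical [OF v] by simp
    have b: "?b > 0" using elim by linarith
    have "ln ?a \<le> ln (C * ?b powr (- (\<nu> - 1)))"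
      using le [of k] a by (intro ln_mono) auto
    also have "\<dots> = ln C - (\<nu> - 1) * ln ?b"
      using C b by (simp add: ln_mult ln_powr algebra_simps)
    finally have 1: "ln ?a \<le> ln C - (\<nu> - 1) * ln ?b" .
    have 2: "ln (s k) = ln ?b - ln ?a"
      using a b by (simp add: s_def ln_div)
    have 3: "ln C \<le> \<nu> * \<epsilon> * ln (s k)"
      using elim(3) \<open>\<epsilon> > 0\<close> \<open>\<nu> > 1\<close> by (simp add: pos_divide_le_eq mult_ac)
    have "\<nu> * \<kappa> * ln (s k) = (\<nu> - 1) * ln (s k) - \<nu> * \<epsilon> * ln (s k)"
      using \<open>\<nu> > 1\<close> by (simp add: \<epsilon>_def field_simps)
    also have "\<dots> \<le> (\<nu> - 1) * ln (s k) - ln C" using 3 by simp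
    also have "\<dots> \<le> \<nu> * (- ln ?a)" using 1 unfolding 2 by (simp add: algebra_simps)
    finally have "\<kappa> * ln (s k) \<le> - ln ?a" using \<open>\<nu> > 1\<close>
      by (metis mult.assoc mult_le_cancel_left_pos less_trans zero_less_one)
    moreover have "ln (1 / ?a) = - ln ?a"
      using a by (simp add: ln_div)
    ultimately show ?case
      using elim(2) by (subst pos_le_divide_eq) auto
  qed
  then have "\<exists>\<^sub>F k in sequentially. \<exists>w\<in>Lam x. s k = norm (p2 w) / norm (p1 w) \<and>
      \<kappa> \<le> ln (1 / norm (p1 w)) / ln (s k)"
    using v by (intro eventually_frequently) (auto simp: s_def elim!: eventually_mono)
  then show ?thesis
    using s_lim by (auto simp: frequently_def filterlim_iff)
qed

lemma one_minus_inverse_ereal_iff: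
  fixes \<mu> :: ereal
  assumes "\<kappa> < 1" "\<mu> > 0"
  shows "ereal \<kappa> < 1 - 1 / \<mu> \<longleftrightarrow> ereal (1 / (1 - \<kappa>)) < \<mu>"
    and "ereal \<kappa> \<le> 1 - 1 / \<mu> \<longleftrightarrow> ereal (1 / (1 - \<kappa>)) \<le> \<mu>"
  using assms by (cases \<mu>; auto simp: one_ereal_def field_simps)+

text \<open>
  Both growth rates in the theorem are upper limits of a function \<open>Q\<close> of the scale \<open>s\<close>
  (with \<open>s = e\<^sup>t\<close> for the diagonal flow) that records, up to constants, the best \<open>\<kappa>\<close> for which
  some vector satisfies \<open>|p1 v| \<le> s\<^sup>-\<^sup>\<kappa>\<close> and \<open>|p2 v| \<le> s\<^sup>1\<^sup>-\<^sup>\<kappa>\<close>.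
\<close>

lemma Limsup_eq_exponent:
  fixes Lam :: "'x \<Rightarrow> (real^('m::finite + 'n::finite)) set" and Q :: "real \<Rightarrow> ereal"
  assumes discrete: "\<And>S. bounded S \<Longrightarrow> finite (Lam x \<inter> S)"
    and nonvertical: "\<And>v. v \<in> Lam x \<Longrightarrow> p1 v \<noteq> 0"
    and exponent: "\<nu> \<in> Exp_set Lam x" "\<nu> > 1"
    and lower: "\<And>v. v \<in> Lam x \<Longrightarrow> norm (p2 v) / norm (p1 v) > 1 \<Longrightarrow>
        ereal (ln (1 / norm (p1 v)) / ln (norm (p2 v) / norm (p1 v)))
          \<le> Q (norm (p2 v) / norm (p1 v))"
    and upper: "\<And>\<kappa> s. s > 1 \<Longrightarrow> ereal \<kappa> < Q s \<Longrightarrow>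
        \<exists>v\<in>Lam x. norm (p1 v) \<le> s powr (- \<kappa>) \<and> norm (p2 v) \<le> 2 * s powr (1 - \<kappa>)"
  shows "Limsup at_top Q = 1 - 1 / mu Lam x"
proof (rule antisym)
  have mu_ge: "ereal \<nu>' \<le> mu Lam x" if "\<nu>' \<in> Exp_set Lam x" for \<nu>'
    unfolding mu_def using that by (intro SUP_upper)
  have mu_pos: "mu Lam x > 0"
    using mu_ge [OF exponent(1)] exponent(2) by (meson ereal_less(2) less_le_trans less_trans zero_less_one)
  have pos: "0 < 1 - 1 / mu Lam x"
  proof -
    have "ereal (1 / (1 - 0)) < ereal \<nu>" using exponent(2) by simp
    also have "\<dots> \<le> mu Lam x" by (rule mu_ge [OF exponent(1)])
    finally show ?thesis
      using one_minus_inverse_ereal_iff(1) [of 0, OF _ mu_pos] by (simp add: zero_ereal_def)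
  qed
  show "Limsup at_top Q \<le> 1 - 1 / mu Lam x"
  proof (rule ccontr)
    assume "\<not> ?thesis"
    then obtain \<kappa> where \<kappa>: "1 - 1 / mu Lam x < ereal \<kappa>" "ereal \<kappa> < Limsup at_top Q"
      using ereal_dense2 by (metis not_le)
    have "\<kappa> > 0" using pos \<kappa>(1) by (metis ereal_less(2) less_trans)
    have "\<exists>\<^sub>F s in at_top. ereal \<kappa> < Q s"
    proof (rule ccontr)
      assume "\<not> ?thesis"
      then have "\<forall>\<^sub>F s in at_top. Q s \<le> ereal \<kappa>"
        by (simp add: not_frequently not_less)
      then have "Limsup at_top Q \<le> ereal \<kappa>" by (rule Limsup_bounded)
      with \<kappa> show False by simp
    qed
    then have "\<exists>\<^sub>F s in at_top. ereal \<kappa> < Q s \<and> s > 1"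
      by (intro frequently_eventually_frequently eventually_gt_at_top)
    then have "\<exists>\<^sub>F s in at_top. \<exists>v\<in>Lam x.
        norm (p1 v) \<le> s powr (- \<kappa>) \<and> norm (p2 v) \<le> 2 * s powr (1 - \<kappa>)"
      by (rule frequently_elim1) (use upper in blast)
    note E = Exp_set_of_scales [where x = x and Lam = Lam and K = 2,
        OF discrete nonvertical \<open>\<kappa> > 0\<close> zero_less_numeral this]
    have "ereal (1 / (1 - \<kappa>)) \<le> mu Lam x" using E(2) by (rule mu_ge)
    then have "ereal \<kappa> \<le> 1 - 1 / mu Lam x"
      using one_minus_inverse_ereal_iff(2) [OF E(1) mu_pos] by simp
    with \<kappa>(1) show False by simp
  qed
  show "1 - 1 / mu Lam x \<le> Limsup at_top Q"
  proof (rule ccontr)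
    assume "\<not> ?thesis"
    then obtain \<kappa> where \<kappa>: "max 0 (Limsup at_top Q) < ereal \<kappa>" "ereal \<kappa> < 1 - 1 / mu Lam x"
      using ereal_dense2 [of "max 0 (Limsup at_top Q)" "1 - 1 / mu Lam x"] pos
      by (metis max_less_iff_conj not_le)
    have "1 - 1 / mu Lam x \<le> 1"
      using mu_pos by (cases "mu Lam x") (auto simp: one_ereal_def)
    then have "\<kappa> < 1" using \<kappa>(2) by (metis ereal_less(3) less_le_trans)
    then obtain \<nu>' where \<nu>': "\<nu>' \<in> Exp_set Lam x" "1 / (1 - \<kappa>) < \<nu>'"
      using one_minus_inverse_ereal_iff(1) [OF _ mu_pos] \<kappa>(2)
      unfolding mu_def less_SUP_iff by auto
    have "\<kappa> > 0" using \<kappa>(1) by simp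
    then have "1 < 1 / (1 - \<kappa>)" using \<open>\<kappa> < 1\<close> by simp
    then have "\<nu>' > 1" using \<nu>'(2) by simp
    have "\<kappa> < 1 - 1 / \<nu>'"
      using \<nu>'(2) \<open>\<nu>' > 1\<close> \<open>\<kappa> < 1\<close> by (simp add: field_simps)
    from scales_of_Exp_set [OF nonvertical \<nu>'(1) \<open>\<nu>' > 1\<close> this]
    have "\<exists>\<^sub>F s in at_top. (\<exists>v\<in>Lam x. s = norm (p2 v) / norm (p1 v) \<and>
        \<kappa> \<le> ln (1 / norm (p1 v)) / ln s) \<and> s > 1"
      by (intro frequently_eventually_frequently eventually_gt_at_top)
    then have "\<exists>\<^sub>F s in at_top. ereal \<kappa> \<le> Q s"
    proof (rule frequently_elim1)
      fix s assume "(\<exists>v\<in>Lam x. s = norm (p2 v) / norm (p1 v) \<and>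
        \<kappa> \<le> ln (1 / norm (p1 v)) / ln s) \<and> s > 1"
      then obtain v where v: "v \<in> Lam x" "s = norm (p2 v) / norm (p1 v)" "s > 1"
          "ereal \<kappa> \<le> ereal (ln (1 / norm (p1 v)) / ln s)"
        by auto
      note v(4)
      also have "ereal (ln (1 / norm (p1 v)) / ln s) \<le> Q s"
        using lower [OF v(1)] v(3) unfolding v(2) by blast
      finally show "ereal \<kappa> \<le> Q s" .
    qed
    moreover have "\<forall>\<^sub>F s in at_top. Q s < ereal \<kappa>"
      using \<kappa>(1) by (intro Limsup_lessD) simp
    ultimately show False
      by (auto simp: frequently_def not_le)
  qed
qed

section \<open>Minkowski systems\<close>

text \<open>The lower bound is the volume of an inscribed coordinate box.\<close>

lemma emeasure_product_of_balls_ge: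
  assumes "0 \<le> \<epsilon>" "0 \<le> R"
  shows "emeasure lebesgue {v :: real^('m::finite + 'n::finite). norm (p1 v) \<le> \<epsilon> \<and> norm (p2 v) \<le> R}
     \<ge> ennreal ((2 * \<epsilon> / real CARD('m)) ^ CARD('m) * (2 * R / real CARD('n)) ^ CARD('n))"
proof -
  define w :: "real^('m + 'n)" where
    "w = (\<chi> i. case i of Inl _ \<Rightarrow> \<epsilon> / real CARD('m) | Inr _ \<Rightarrow> R / real CARD('n))"
  let ?K = "{v :: real^('m + 'n). norm (p1 v) \<le> \<epsilon> \<and> norm (p2 v) \<le> R}"
  have "cbox (- w) w \<subseteq> ?K"
  proof
    fix v assume v: "v \<in> cbox (- w) w"
    have 1: "\<bar>p1 v $ i\<bar> \<le> \<epsilon> / real CARD('m)" for i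
      using v by (auto simp: mem_box_cart w_def p1_def abs_le_iff dest!: spec [of _ "Inl i"])
    have 2: "\<bar>p2 v $ i\<bar> \<le> R / real CARD('n)" for i
      using v by (auto simp: mem_box_cart w_def p2_def abs_le_iff dest!: spec [of _ "Inr i"])
    have "norm (p1 v) \<le> (\<Sum>i\<in>(UNIV :: 'm set). \<epsilon> / real CARD('m))"
      using norm_le_l1_cart sum_mono 1 by (metis (no_types, lifting) order_trans)
    moreover have "norm (p2 v) \<le> (\<Sum>i\<in>(UNIV :: 'n set). R / real CARD('n))"
      using norm_le_l1_cart sum_mono 2 by (metis (no_types, lifting) order_trans)
    ultimately show "v \<in> ?K" by simp
  qed
  moreover have "?K \<in> sets lebesgue"
  proof -
    have "closed ?K"
      unfolding p1_def p2_def by (intro closed_Collect_conj closed_Collect_le continuous_intros)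
    then show ?thesis by simp
  qed
  ultimately have "emeasure lebesgue (cbox (- w) w) \<le> emeasure lebesgue ?K"
    by (rule emeasure_mono)
  moreover have "- w \<in> cbox (- w) w"
    using assms by (auto simp: mem_box_cart w_def split: sum.splits)
  then have "cbox (- w) w \<noteq> {}" by blast
  then have "measure lborel (cbox (- w) w)
      = (2 * \<epsilon> / real CARD('m)) ^ CARD('m) * (2 * R / real CARD('n)) ^ CARD('n)"
    by (simp add: content_cbox_cart prod_UNIV_sum w_def)
  moreover have "emeasure lebesgue (cbox (- w) w) = ennreal (measure lborel (cbox (- w) w))"
    using emeasure_lborel_cbox_finite [of "- w" w]
    by (simp add: emeasure_eq_ennreal_measure less_top [symmetric])
  ultimately show ?thesis by simp
qed

context minkowski_system
begin

lemma act_in_space: "det g = 1 \<Longrightarrow> x \<in> topspace X \<Longrightarrow> act g x \<in> topspace X"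
  using element_image [of g x] by (auto simp: SL_group_def)

end

text \<open>
  The Minkowski condition is applied to the bodies of all \<open>v\<close> with \<open>|p1 v| \<le> s\<^sup>-\<^sup>\<kappa>\<close> and
  \<open>|p2 v| \<le> K s\<^sup>1\<^sup>-\<^sup>\<kappa>\<close> for \<open>\<kappa> = n/d\<close>.  Their volume does not depend on \<open>s\<close> and is large for large \<open>K\<close>.
\<close>

lemma Dirichlet_exponent:
  fixes X :: "'x topology"
    and act :: "real^('m::finite + 'n::finite)^('m + 'n) \<Rightarrow> 'x \<Rightarrow> 'x"
    and Lam :: "'x \<Rightarrow> (real^('m + 'n)) set"
  assumes "minkowski_system X act Lam" "x \<in> topspace X"
    and nonvertical: "\<And>v. v \<in> Lam x \<Longrightarrow> p1 v \<noteq> 0"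
  shows "(real CARD('m) + real CARD('n)) / real CARD('m) \<in> Exp_set Lam x"
proof -
  interpret minkowski_system X act Lam by fact
  define m n where "m = real CARD('m)" and "n = real CARD('n)"
  have mn: "m > 0" "n > 0" by (auto simp: m_def n_def)
  define \<kappa> where "\<kappa> = n / (m + n)"
  have \<kappa>: "\<kappa> > 0" "1 - \<kappa> = m / (m + n)" using mn by (auto simp: \<kappa>_def field_simps)
  obtain C :: real where C: "\<And>K. convex K \<Longrightarrow> (\<forall>v\<in>K. - v \<in> K) \<Longrightarrow>
      emeasure lebesgue K > ennreal C \<Longrightarrow> \<exists>v\<in>Lam x. v \<in> K"
    using minkowski_condition [OF assms(2)] by metis
  define c where "c = (2 / m) ^ CARD('m) * (2 / n) ^ CARD('n)"
  have "c > 0" using mn by (simp add: c_def)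
  \<comment> \<open>The box inside the convex body has volume \<open>c K\<^sup>n\<close>, so this choice makes it exceed \<open>C\<close>.\<close>
  define K where "K = 1 + \<bar>C\<bar> / c"
  have "K \<ge> 1" using \<open>c > 0\<close> by (simp add: K_def)
  have "\<exists>v\<in>Lam x. norm (p1 v) \<le> s powr (- \<kappa>) \<and> norm (p2 v) \<le> K * s powr (1 - \<kappa>)"
    if "s > 0" for s :: real
  proof -
    define \<epsilon> R where "\<epsilon> = s powr (- \<kappa>)" and "R = K * s powr (1 - \<kappa>)"
    let ?K = "{v :: real^('m + 'n). norm (p1 v) \<le> \<epsilon> \<and> norm (p2 v) \<le> R}"
    have "\<epsilon> ^ CARD('m) * (s powr (1 - \<kappa>)) ^ CARD('n) = s powr (- \<kappa> * m + (1 - \<kappa>) * n)"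
      using that by (simp add: \<epsilon>_def powr_power m_def n_def mult.commute flip: powr_add)
    also have "- \<kappa> * m + (1 - \<kappa>) * n = 0"
      unfolding \<kappa>(2) by (simp add: \<kappa>_def)
    finally have prod: "\<epsilon> ^ CARD('m) * (s powr (1 - \<kappa>)) ^ CARD('n) = 1"
      using that by simp
    have "\<bar>C\<bar> < c * K" using \<open>c > 0\<close> by (simp add: K_def field_simps)
    also have "\<dots> \<le> c * K ^ CARD('n)"
      using \<open>c > 0\<close> \<open>K \<ge> 1\<close> by (intro mult_left_mono self_le_power) auto
    also have "\<dots> = c * K ^ CARD('n) * (\<epsilon> ^ CARD('m) * (s powr (1 - \<kappa>)) ^ CARD('n))"
      by (simp only: prod mult_1_right)
    also have "\<dots> = (2 * \<epsilon> / m) ^ CARD('m) * (2 * R / n) ^ CARD('n)"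
      by (simp add: c_def R_def power_mult_distrib power_divide)
    finally have less: "\<bar>C\<bar> < (2 * \<epsilon> / m) ^ CARD('m) * (2 * R / n) ^ CARD('n)" .
    have nonneg: "0 \<le> \<epsilon>" "0 \<le> R" using \<open>K \<ge> 1\<close> by (auto simp: \<epsilon>_def R_def)
    have "ennreal C < ennreal ((2 * \<epsilon> / m) ^ CARD('m) * (2 * R / n) ^ CARD('n))"
      using less by (intro ennreal_lessI) auto
    also have "\<dots> \<le> emeasure lebesgue ?K"
      unfolding m_def n_def by (rule emeasure_product_of_balls_ge [OF nonneg])
    finally have vol: "emeasure lebesgue ?K > ennreal C" .
    have sym: "\<forall>v\<in>?K. - v \<in> ?K"
    proof -
      have "p1 (- v) = - p1 v" "p2 (- v) = - p2 v" for v :: "real^('m + 'n)"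
        by (simp_all add: p1_def p2_def vec_eq_iff)
      then show ?thesis by simp
    qed
    have conv: "convex ?K"
    proof -
      have "linear (p1 :: real^('m + 'n) \<Rightarrow> _)" "linear (p2 :: real^('m + 'n) \<Rightarrow> _)"
        by (auto intro!: linearI simp: p1_def p2_def vec_eq_iff)
      then have "convex (p1 -` cball 0 \<epsilon> \<inter> p2 -` cball 0 R :: (real^('m + 'n)) set)"
        by (intro convex_Int convex_linear_vimage convex_cball)
      also have "p1 -` cball 0 \<epsilon> \<inter> p2 -` cball 0 R = ?K" by auto
      finally show ?thesis .
    qed
    have "\<exists>v\<in>Lam x. v \<in> ?K"
      by (rule C [OF conv sym vol])
    then show ?thesis
      unfolding \<epsilon>_def R_def by blast
  qed
  then have "\<forall>\<^sub>F s in at_top. \<exists>v\<in>Lam x.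
      norm (p1 v) \<le> s powr (- \<kappa>) \<and> norm (p2 v) \<le> K * s powr (1 - \<kappa>)"
    by (rule eventually_mono [OF eventually_gt_at_top])
  then have scales: "\<exists>\<^sub>F s in at_top. \<exists>v\<in>Lam x.
      norm (p1 v) \<le> s powr (- \<kappa>) \<and> norm (p2 v) \<le> K * s powr (1 - \<kappa>)"
    by (intro eventually_frequently) auto
  have "K > 0" using \<open>K \<ge> 1\<close> by simp
  have "1 / (1 - \<kappa>) \<in> Exp_set Lam x"
    by (rule Exp_set_of_scales(2) [where x = x and Lam = Lam and K = K and \<kappa> = \<kappa>,
          OF discrete_Lam [OF assms(2)] nonvertical \<kappa>(1) \<open>K > 0\<close> scales])
  then show ?thesis
    using mn by (simp add: \<kappa>(2) m_def n_def)
qed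

lemma alpha1_act:
  fixes X :: "'x topology"
    and act :: "real^('m::finite + 'n::finite)^('m + 'n) \<Rightarrow> 'x \<Rightarrow> 'x"
    and Lam :: "'x \<Rightarrow> (real^('m + 'n)) set"
  assumes "minkowski_system X act Lam" "x \<in> topspace X" "det g = 1"
  shows inverse_max_norm_le_alpha1: "v \<in> Lam x \<Longrightarrow> 1 / max_norm (g *v v) \<le> alpha1 Lam (act g x)"
    and alpha1_act_pos: "alpha1 Lam (act g x) > 0"
    and less_alpha1_act: "c > 0 \<Longrightarrow> c < alpha1 Lam (act g x) \<Longrightarrow> \<exists>v\<in>Lam x. max_norm (g *v v) < 1 / c"
proof -
  interpret minkowski_system X act Lam by fact
  let ?y = "act g x"
  have y: "?y \<in> topspace X" by (rule act_in_space) fact+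
  have Lam_y: "Lam ?y = (\<lambda>v. g *v v) ` Lam x" by (rule equivariant) fact+
  have bdd: "bdd_above ((\<lambda>v. 1 / max_norm v) ` Lam ?y)"
    by (rule bdd_above_inverse_max_norm) (rule discrete_Lam [OF y])
  have pos: "max_norm w > 0" if "w \<in> Lam ?y" for w
    using that zero_notin [OF y] by (metis max_norm_pos)
  have ne: "Lam ?y \<noteq> {}" using infinite_Lam [OF y] by auto
  show "1 / max_norm (g *v v) \<le> alpha1 Lam ?y" if "v \<in> Lam x" for v
    unfolding alpha1_def using that by (intro cSUP_upper bdd) (simp add: Lam_y)
  obtain w where "w \<in> Lam ?y" using ne by auto
  then have "1 / max_norm w \<le> alpha1 Lam ?y" "0 < 1 / max_norm w"
    unfolding alpha1_def using pos by (auto intro!: cSUP_upper bdd)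
  then show "alpha1 Lam ?y > 0" by linarith
  show "\<exists>v\<in>Lam x. max_norm (g *v v) < 1 / c" if c: "c > 0" "c < alpha1 Lam ?y"
  proof -
    obtain w where w: "w \<in> Lam ?y" "c < 1 / max_norm w"
      using c(2) unfolding alpha1_def less_cSUP_iff [OF ne bdd] by blast
    then have "max_norm w < 1 / c" using pos [OF w(1)] c(1) by (simp add: field_simps)
    then show ?thesis using w(1) by (auto simp: Lam_y)
  qed
qed

text \<open>A vector with \<open>|p2 v| / |p1 v| = s\<close> can be sheared into the horizontal plane by \<open>B\<close> with \<open>|B| = s\<close>.\<close>

lemma beta_eq_exponent:
  fixes X :: "'x topology"
    and act :: "real^('m::finite + 'n::finite)^('m + 'n) \<Rightarrow> 'x \<Rightarrow> 'x"
    and Lam :: "'x \<Rightarrow> (real^('m + 'n)) set"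
  assumes sys: "minkowski_system X act Lam" "x \<in> topspace X"
    and nonvertical: "\<And>v. v \<in> Lam x \<Longrightarrow> p1 v \<noteq> 0"
  shows "beta act Lam x = 1 - 1 / mu Lam x"
  unfolding beta_def
proof (rule Limsup_eq_exponent)
  show "finite (Lam x \<inter> S)" if "bounded S" for S
    using minkowski_system.discrete_Lam [OF sys that] .
  show "(real CARD('m) + real CARD('n)) / real CARD('m) \<in> Exp_set Lam x"
    by (rule Dirichlet_exponent) fact+
  show "1 < (real CARD('m) + real CARD('n)) / real CARD('m)"
    by simp
next
  fix v assume v: "v \<in> Lam x" "1 < norm (p2 v) / norm (p1 v)"
  let ?s = "norm (p2 v) / norm (p1 v)"
  have a: "norm (p1 v) > 0" using nonvertical [OF v(1)] by simp
  obtain B where B: "B *v p1 v + p2 v = 0" "norm B = ?s"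
    using ex_matrix_cancel [OF nonvertical [OF v(1)]] .
  have "1 / max_norm (shear B *v v) \<le> alpha1 Lam (act (shear B) x)"
    by (rule inverse_max_norm_le_alpha1 [OF sys det_shear v(1)])
  then have "1 / norm (p1 v) \<le> alpha1 Lam (act (shear B) x)"
    by (simp add: max_norm_def p1_shear p2_shear B)
  then have "ln (1 / norm (p1 v)) \<le> ln (alpha1 Lam (act (shear B) x))"
    using a by (intro ln_mono) auto
  also have "ereal \<dots> \<le> (SUP h\<in>shear_ball ?s. ereal (ln (alpha1 Lam (act h x))))"
    by (rule SUP_upper) (use B in \<open>auto simp: shear_ball_def\<close>)
  finally have "ereal (ln (1 / norm (p1 v))) / ereal (ln ?s)
      \<le> (SUP h\<in>shear_ball ?s. ereal (ln (alpha1 Lam (act h x)))) / ereal (ln ?s)"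
    using v(2) by (intro ereal_divide_right_mono) auto
  moreover have "ereal (ln (1 / norm (p1 v))) / ereal (ln ?s) = ereal (ln (1 / norm (p1 v)) / ln ?s)"
  proof -
    have "ereal p / ereal q = ereal (p / q)" if "q > 0" for p q :: real
      using that by simp
    then show ?thesis using v(2) by (metis ln_gt_zero)
  qed
  ultimately show "ereal (ln (1 / norm (p1 v)) / ln ?s)
      \<le> (SUP h\<in>shear_ball ?s. ereal (ln (alpha1 Lam (act h x)))) / ereal (ln ?s)"
    by simp
next
  fix \<kappa> s :: real
  assume s: "1 < s"
    and less: "ereal \<kappa> < (SUP h\<in>shear_ball s. ereal (ln (alpha1 Lam (act h x)))) / ereal (ln s)"
  have "ereal (\<kappa> * ln s) < (SUP h\<in>shear_ball s. ereal (ln (alpha1 Lam (act h x))))"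
    using less s by (subst (asm) ereal_less_divide_pos) (auto simp: mult.commute)
  then obtain B :: "real^'m^'n" where B: "norm B \<le> s" "\<kappa> * ln s < ln (alpha1 Lam (act (shear B) x))"
    by (auto simp: less_SUP_iff shear_ball_def)
  have "s powr \<kappa> < alpha1 Lam (act (shear B) x)"
    using B(2) s alpha1_act_pos [OF sys det_shear, of B]
    by (metis exp_less_mono exp_ln powr_def less_irrefl less_trans zero_less_one)
  then obtain v where v: "v \<in> Lam x" "max_norm (shear B *v v) < 1 / s powr \<kappa>"
    using less_alpha1_act [OF sys det_shear, of "s powr \<kappa>" B] s by auto
  then have 1: "norm (p1 v) < s powr (- \<kappa>)" "norm (B *v p1 v + p2 v) < s powr (- \<kappa>)"
    by (auto simp: max_norm_def p1_shear p2_shear powr_minus_divide)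
  have "norm (p2 v) \<le> norm (B *v p1 v + p2 v) + norm (B *v p1 v)"
    using norm_triangle_ineq4 [of "B *v p1 v + p2 v" "B *v p1 v"] by simp
  moreover have "norm (B *v p1 v) \<le> s * s powr (- \<kappa>)"
    using B(1) 1(1) s norm_matrix_vector_mult_le [of B "p1 v"]
    by (smt (verit) mult_mono norm_ge_zero)
  moreover have "s * s powr (- \<kappa>) = s powr (1 - \<kappa>)"
    using s by (simp add: powr_diff powr_minus field_simps)
  moreover have "s powr (- \<kappa>) \<le> s powr (1 - \<kappa>)"
    using s by (intro powr_mono) auto
  ultimately have "norm (p2 v) \<le> 2 * s powr (1 - \<kappa>)"
    using 1 by linarith
  then show "\<exists>v\<in>Lam x. norm (p1 v) \<le> s powr (- \<kappa>) \<and> norm (p2 v) \<le> 2 * s powr (1 - \<kappa>)"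
    using v(1) 1(1) by (intro bexI [of _ v]) auto
qed (use nonvertical in auto)

text \<open>
  With \<open>s = e\<^sup>t\<close>, the diagonal flow stretches \<open>p1 v\<close> and contracts \<open>p2 v\<close> by factors whose quotient
  is \<open>s\<close>; a vector with \<open>|p2 v| / |p1 v| = s\<close> is brought into balanced position.
\<close>

lemma gamma_eq_exponent:
  fixes X :: "'x topology"
    and act :: "real^('m::finite + 'n::finite)^('m + 'n) \<Rightarrow> 'x \<Rightarrow> 'x"
    and Lam :: "'x \<Rightarrow> (real^('m + 'n)) set"
  assumes sys: "minkowski_system X act Lam" "x \<in> topspace X"
    and nonvertical: "\<And>v. v \<in> Lam x \<Longrightarrow> p1 v \<noteq> 0"
  shows "ereal (real CARD('n) / real (CARD('m) + CARD('n))) + gamma act Lam x = 1 - 1 / mu Lam x"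
proof -
  define m n where "m = real CARD('m)" and "n = real CARD('n)"
  have mn: "m > 0" "n > 0" by (auto simp: m_def n_def)
  define \<theta> where "\<theta> = n / (m + n)"
  have \<theta>: "1 - \<theta> = m / (m + n)" using mn by (simp add: \<theta>_def field_simps)
  define Q where "Q s = ereal (\<theta> + ln (alpha1 Lam (act (diag_flow (ln s)) x)) / ln s)" for s :: real
  have max_norm_flow: "max_norm (diag_flow (ln s) *v v)
      = max (s powr \<theta> * norm (p1 v)) (s powr (\<theta> - 1) * norm (p2 v))"
    if "s > 1" for s and v :: "real^('m + 'n)"
  proof -
    have "\<theta> - 1 = - (m / (m + n))" using \<theta> by simp
    then show ?thesis
      using that by (simp add: max_norm_def p1_diag_flow p2_diag_flow powr_def \<theta>_def m_def n_def)
  qed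
  have "Limsup at_top Q = 1 - 1 / mu Lam x"
  proof (rule Limsup_eq_exponent)
    show "finite (Lam x \<inter> S)" if "bounded S" for S
      using minkowski_system.discrete_Lam [OF sys that] .
    show "(real CARD('m) + real CARD('n)) / real CARD('m) \<in> Exp_set Lam x"
      by (rule Dirichlet_exponent) fact+
    show "1 < (real CARD('m) + real CARD('n)) / real CARD('m)"
      by simp
  next
    fix v assume v: "v \<in> Lam x" "1 < norm (p2 v) / norm (p1 v)"
    define s where "s = norm (p2 v) / norm (p1 v)"
    let ?\<alpha> = "alpha1 Lam (act (diag_flow (ln s)) x)"
    have a: "norm (p1 v) > 0" using nonvertical [OF v(1)] by simp
    have s: "s > 1" using v(2) by (simp add: s_def)
    have "s powr (\<theta> - 1) * norm (p2 v) = s powr \<theta> * norm (p1 v)"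
      using a s by (simp add: powr_diff) (simp add: s_def)
    then have "max_norm (diag_flow (ln s) *v v) = s powr \<theta> * norm (p1 v)"
      by (simp add: max_norm_flow [OF s])
    then have "1 / (s powr \<theta> * norm (p1 v)) \<le> ?\<alpha>"
      using inverse_max_norm_le_alpha1 [OF sys det_diag_flow v(1), of "ln s"] by simp
    then have "ln (1 / (s powr \<theta> * norm (p1 v))) \<le> ln ?\<alpha>"
      using a s by (intro ln_mono) auto
    then have "ln (1 / norm (p1 v)) \<le> \<theta> * ln s + ln ?\<alpha>"
      using a s by (simp add: ln_div ln_mult ln_powr)
    then have "ln (1 / norm (p1 v)) / ln s \<le> \<theta> + ln ?\<alpha> / ln s"
      using s by (simp add: field_simps)
    then show "ereal (ln (1 / norm (p1 v)) / ln (norm (p2 v) / norm (p1 v)))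
        \<le> Q (norm (p2 v) / norm (p1 v))"
      by (simp add: Q_def s_def)
  next
    fix \<kappa> s :: real
    assume s: "1 < s" and less: "ereal \<kappa> < Q s"
    let ?\<alpha> = "alpha1 Lam (act (diag_flow (ln s)) x)"
    have "(\<kappa> - \<theta>) * ln s < ln ?\<alpha>"
      using less s by (simp add: Q_def field_simps)
    then have "s powr (\<kappa> - \<theta>) < ?\<alpha>"
      using s alpha1_act_pos [OF sys det_diag_flow, of "ln s"]
      by (metis exp_less_mono exp_ln powr_def less_irrefl less_trans zero_less_one)
    then obtain v where v: "v \<in> Lam x" "max_norm (diag_flow (ln s) *v v) < 1 / s powr (\<kappa> - \<theta>)"
      using less_alpha1_act [OF sys det_diag_flow, of "s powr (\<kappa> - \<theta>)" "ln s"] s by auto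
    then have "s powr \<theta> * norm (p1 v) < s powr (\<theta> - \<kappa>)"
        "s powr (\<theta> - 1) * norm (p2 v) < s powr (\<theta> - \<kappa>)"
      using powr_minus_divide [of s "\<kappa> - \<theta>"] by (auto simp: max_norm_flow [OF s])
    moreover have "s powr (\<theta> - \<kappa>) = s powr \<theta> * s powr (- \<kappa>)"
        "s powr (\<theta> - \<kappa>) = s powr (\<theta> - 1) * s powr (1 - \<kappa>)"
      by (simp_all flip: powr_add)
    moreover have "s powr \<theta> > 0" "s powr (\<theta> - 1) > 0"
      using s by simp_all
    ultimately have "norm (p1 v) < s powr (- \<kappa>)" "norm (p2 v) < s powr (1 - \<kappa>)"
      by (metis mult_less_cancel_left_pos)+
    moreover have "0 \<le> s powr (1 - \<kappa>)" by simp
    ultimately have "norm (p1 v) \<le> s powr (- \<kappa>)" "norm (p2 v) \<le> 2 * s powr (1 - \<kappa>)"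
      by linarith+
    then show "\<exists>v\<in>Lam x. norm (p1 v) \<le> s powr (- \<kappa>) \<and> norm (p2 v) \<le> 2 * s powr (1 - \<kappa>)"
      using v(1) by blast
  qed (use nonvertical in auto)
  also have "Limsup at_top Q = Limsup (filtermap exp at_top) Q"
    by (simp add: filtermap_exp_at_top)
  also have "\<dots> = Limsup at_top (\<lambda>t. Q (exp t))"
    by (rule Limsup_filtermap_eq) (auto simp: inj_def)
  also have "\<dots> = ereal \<theta> + gamma act Lam x"
    unfolding gamma_def Q_def by (subst Limsup_add_ereal_left [symmetric]) auto
  finally show ?thesis
    by (simp add: \<theta>_def m_def n_def)
qed

theorem theorem2p1:
  fixes X :: "'x topology"
    and act :: "real^('m::finite + 'n::finite)^('m + 'n) \<Rightarrow> 'x \<Rightarrow> 'x"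
    and Lam :: "'x \<Rightarrow> (real^('m + 'n)) set"
    and x :: 'x
  assumes "minkowski_system X act Lam"
    and "x \<in> topspace X"
    and "\<forall>v\<in>Lam x. \<not> vertical v"
  shows "beta act Lam x = ereal (real CARD('n) / real (CARD('m) + CARD('n))) + gamma act Lam x \<and>
         ereal (real CARD('n) / real (CARD('m) + CARD('n))) + gamma act Lam x = 1 - 1 / mu Lam x"
proof -
  have nonvertical: "p1 v \<noteq> 0" if "v \<in> Lam x" for v
    using assms(3) that by (auto simp: vertical_def)
  show ?thesis
    using beta_eq_exponent [OF assms(1,2) nonvertical] gamma_eq_exponent [OF assms(1,2) nonvertical]
    by simp
qed

end
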